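(* Let $G=(V,w,m)$ be a graph and let $x_0\neq y_0$ be vertices. Then $$\kappa(x_0,y_0)=\sup_\rho\sum_{\substack{x\in B_1(x_0)\\ y\in B_1(y_0)}}\rho(x,y)\left[1-\frac{d(x,y)}{d(x_0,y_0)}\right]$$ where the supremum is taken over all $\rho:B_1(x_0)\times B_1(y_0)\to[0,\infty)$ such that $$\sum_{y\in B_1(y_0)}\rho(x,y)=\frac{w(x_0,x)}{m(x_0)}\quad\text{for all }x\in S_1(x_0)$$ and $$\sum_{x\in B_1(x_0)}\rho(x,y)=\frac{w(y_0,y)}{m(y_0)}\quad\text{for all }y\in S_1(y_0).$$
   Context: A graph is a triple $G=(V,w,m)$ with $V$ a countable set, $w:V\times V\to[0,\infty)$ symmetric and zero on the diagonal, and $m:V\to(0,\infty)$. Write $x\sim y$ if $w(x,y)>0$. All graphs are locally finite (for each $x$ only finitely many $y$ satisfy $x\sim y$) and connected; $d(x,y)=\inf\{n: x=x_0\sim\cdots\sim x_n=y\}$ is the combinatorial distance, which is finite by connectedness. $B_1(x)=\{y: d(x,y)\le1\}$ and $S_1(x)=\{y:d(x,y)=1\}$. $\mathrm{Deg}(x)=\frac1{m(x)}\sum_{y}w(x,y)$. $Lip(1)$ is the set of $f:V\to\mathbb R$ with $|f(x)-f(y)|\le d(x,y)$ for all $x,y$. Curvature: for $x\in V$ and $\varepsilon>0$ let $m_x^\varepsilon(x)=1-\varepsilon\,\mathrm{Deg}(x)$ and $m_x^\varepsilon(y)=\varepsilon w(x,y)/m(x)$ for $y\neq x$; this is a finitely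 supported probability measure for $\varepsilon$ small. For probability measures $\mu,\nu$ on $V$, $W(\mu,\nu)=\sup_{f}\sum_{x}f(x)(\mu(x)-\nu(x))$, the supremum over bounded $f\in Lip(1)$; equivalently, $W(\mu,\nu)$ is the $L^1$ optimal transport cost with cost $d$. For $x\neq y$ let $\kappa_\varepsilon(x,y)=1-\frac{W(m_x^\varepsilon,m_y^\varepsilon)}{d(x,y)}$ and $\kappa(x,y)=\lim_{\varepsilon\to0^+}\frac1\varepsilon\kappa_\varepsilon(x,y)$ (this limit exists). *)

theory Defs
  imports "HOL-Analysis.Analysis"
begin

text \<open>
  The vertex set is an explicit carrier \<open>V\<close>. The values of \<open>w\<close>, \<open>m\<close> and of all functions and
  measures on vertices matter only on \<open>V\<close>.
\<close>

definition adj :: "'a set \<Rightarrow> ('a \<Rightarrow> 'a \<Rightarrow> real) \<Rightarrow> 'a \<Rightarrow> 'a \<Rightarrow> bool" where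
  "adj V w x y \<longleftrightarrow> x \<in> V \<and> y \<in> V \<and> w x y > 0"

locale weighted_graph =
  fixes V :: "'a set" and w :: "'a \<Rightarrow> 'a \<Rightarrow> real" and m :: "'a \<Rightarrow> real"
  assumes countable_vertices: "countable V"
    and weight_nonneg: "\<And>x y. x \<in> V \<Longrightarrow> y \<in> V \<Longrightarrow> w x y \<ge> 0"
    and weight_sym: "\<And>x y. x \<in> V \<Longrightarrow> y \<in> V \<Longrightarrow> w x y = w y x"
    and weight_diag: "\<And>x. x \<in> V \<Longrightarrow> w x x = 0"
    and measure_pos: "\<And>x. x \<in> V \<Longrightarrow> m x > 0"
    and locally_finite: "\<And>x. x \<in> V \<Longrightarrow> finite {y. adj V w x y}"
    and connected_graph: "\<And>x y. x \<in> V \<Longrightarrow> y \<in> V \<Longrightarrow> (adj V w)\<^sup>*\<^sup>* x y"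

text \<open>The relation power \<open>adj V w ^^ n\<close> holds between the end points of walks with \<open>n\<close> edges.\<close>

definition gdist :: "'a set \<Rightarrow> ('a \<Rightarrow> 'a \<Rightarrow> real) \<Rightarrow> 'a \<Rightarrow> 'a \<Rightarrow> nat" where
  "gdist V w x y = Inf {n. (adj V w ^^ n) x y}"

definition ball1 :: "'a set \<Rightarrow> ('a \<Rightarrow> 'a \<Rightarrow> real) \<Rightarrow> 'a \<Rightarrow> 'a set" where
  "ball1 V w x = {y \<in> V. gdist V w x y \<le> 1}"

definition sphere1 :: "'a set \<Rightarrow> ('a \<Rightarrow> 'a \<Rightarrow> real) \<Rightarrow> 'a \<Rightarrow> 'a set" where
  "sphere1 V w x = {y \<in> V. gdist V w x y = 1}"

definition Deg :: "'a set \<Rightarrow> ('a \<Rightarrow> 'a \<Rightarrow> real) \<Rightarrow> ('a \<Rightarrow> real) \<Rightarrow> 'a \<Rightarrow> real" where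
  "Deg V w m x = (1 / m x) * (\<Sum>\<^sub>\<infinity>y\<in>V. w x y)"

definition Lip1 :: "'a set \<Rightarrow> ('a \<Rightarrow> 'a \<Rightarrow> real) \<Rightarrow> ('a \<Rightarrow> real) set" where
  "Lip1 V w = {f. \<forall>x\<in>V. \<forall>y\<in>V. \<bar>f x - f y\<bar> \<le> real (gdist V w x y)}"

text \<open>Measures on \<open>V\<close> are represented by their point masses.\<close>

definition jump_measure ::
  "'a set \<Rightarrow> ('a \<Rightarrow> 'a \<Rightarrow> real) \<Rightarrow> ('a \<Rightarrow> real) \<Rightarrow> real \<Rightarrow> 'a \<Rightarrow> 'a \<Rightarrow> real" where
  "jump_measure V w m \<epsilon> x y = (if y = x then 1 - \<epsilon> * Deg V w m x else \<epsilon> * w x y / m x)"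

text \<open>
  The supremum below is taken in the reals. For finitely supported \<open>\<mu>\<close> and \<open>\<nu>\<close> of equal total
  mass, which is the only case used, the set is bounded above.
\<close>

definition Wasserstein ::
  "'a set \<Rightarrow> ('a \<Rightarrow> 'a \<Rightarrow> real) \<Rightarrow> ('a \<Rightarrow> real) \<Rightarrow> ('a \<Rightarrow> real) \<Rightarrow> real" where
  "Wasserstein V w \<mu> \<nu> =
     (SUP f \<in> {f \<in> Lip1 V w. bounded (f ` V)}. \<Sum>\<^sub>\<infinity>x\<in>V. f x * (\<mu> x - \<nu> x))"

definition curv_eps ::
  "'a set \<Rightarrow> ('a \<Rightarrow> 'a \<Rightarrow> real) \<Rightarrow> ('a \<Rightarrow> real) \<Rightarrow> real \<Rightarrow> 'a \<Rightarrow> 'a \<Rightarrow> real" where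
  "curv_eps V w m \<epsilon> x y =
     1 - Wasserstein V w (jump_measure V w m \<epsilon> x) (jump_measure V w m \<epsilon> y) / real (gdist V w x y)"

definition curvature ::
  "'a set \<Rightarrow> ('a \<Rightarrow> 'a \<Rightarrow> real) \<Rightarrow> ('a \<Rightarrow> real) \<Rightarrow> 'a \<Rightarrow> 'a \<Rightarrow> real" where
  "curvature V w m x y = Lim (at_right 0) (\<lambda>\<epsilon>. (1 / \<epsilon>) * curv_eps V w m \<epsilon> x y)"

text \<open>
  Only the marginals on the spheres are prescribed; the mass at the centres is free. The
  contribution of \<open>\<rho> x0 y0\<close> to the transport functional in the theorem is zero, so the supremum
  over these plans is finite.
\<close>

definition transport_plans ::
  "'a set \<Rightarrow> ('a \<Rightarrow> 'a \<Rightarrow> real) \<Rightarrow> ('a \<Rightarrow> real) \<Rightarrow> 'a \<Rightarrow> 'a \<Rightarrow> ('a \<Rightarrow> 'a \<Rightarrow> real) set" where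
  "transport_plans V w m x0 y0 = {\<rho>.
     (\<forall>x\<in>ball1 V w x0. \<forall>y\<in>ball1 V w y0. \<rho> x y \<ge> 0) \<and>
     (\<forall>x\<in>sphere1 V w x0. (\<Sum>y\<in>ball1 V w y0. \<rho> x y) = w x0 x / m x0) \<and>
     (\<forall>y\<in>sphere1 V w y0. (\<Sum>x\<in>ball1 V w x0. \<rho> x y) = w y0 y / m y0)}"

end

theory Submission
  imports Defs
begin

text \<open>
  Couplings of the two jump measures at time \<open>\<epsilon>\<close> are \<open>\<epsilon>\<close> times the
  admissible \<open>\<rho>\<close>, apart from the entry at \<open>(x0, y0)\<close>, which costs exactly \<open>d(x0, y0)\<close> and so does
  not contribute. By Kantorovich duality, \<open>\<kappa>\<^sub>\<epsilon> / \<epsilon>\<close> therefore already equals the supremum for all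
  small \<open>\<epsilon>\<close>. Duality between finite sets is obtained from the Hahn-Banach theorem applied
  to \<open>p h = inf {\<Sum>\<phi> a + \<Sum>\<psi> b | \<phi> \<oplus> \<psi> \<ge> h}\<close>: a linear functional below \<open>p\<close> is a coupling of
  \<open>a\<close> and \<open>b\<close>.
\<close>

section \<open>Hahn-Banach extension in finitely many coordinates\<close>

text \<open>The functional is fixed on the line through \<open>h0\<close> and extended one
  coordinate direction at a time. Since \<open>p\<close> only sees the coordinates in
  \<open>I\<close>, finitely many coefficients \<open>\<pi>\<close> suffice.\<close>

lemma hahn_banach_coordinates:
  fixes p :: "('i \<Rightarrow> real) \<Rightarrow> real" and h0 :: "'i \<Rightarrow> real"
  assumes "finite I"
    and sub: "\<And>g h. p (\<lambda>i. g i + h i) \<le> p g + p h"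
    and hom: "\<And>t h. 0 < t \<Longrightarrow> p (\<lambda>i. t * h i) \<le> t * p h"
    and loc: "\<And>g h. (\<And>i. i \<in> I \<Longrightarrow> g i = h i) \<Longrightarrow> p g = p h"
  obtains \<pi> where "\<And>h. (\<Sum>i\<in>I. \<pi> i * h i) \<le> p h" and "(\<Sum>i\<in>I. \<pi> i * h0 i) = p h0"
proof -
  \<comment> \<open>The pair \<open>(t, h)\<close> need not be determined by
    \<open>t * h0 + h\<close> when \<open>h0\<close> itself is spanned by coordinates. Stating the
    bound for all pairs avoids proving that a functional on the span is well defined, and this
    redundancy is exploited at the end.\<close>
  define E where "E J t h = (\<lambda>i. t * h0 i + (if i \<in> J then h i else 0))"
    for J :: "'i set" and t :: real and h :: "'i \<Rightarrow> real"
  have p0: "p (\<lambda>_. 0) = 0"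
    using sub[of "\<lambda>_. 0" "\<lambda>_. 0"] hom[of "1/2" "\<lambda>_. 0"] by simp
  have ext: "\<exists>\<pi>. \<forall>t h. t * p h0 + (\<Sum>i\<in>J. \<pi> i * h i) \<le> p (E J t h)" if "finite J" for J
    using that
  proof (induction J rule: finite_induct)
    case empty
    have "t * p h0 \<le> p (\<lambda>i. t * h0 i)" for t
    proof -
      consider "t = 0" | "t > 0" | "t < 0" by linarith
      then show ?thesis
      proof cases
        case 1
        then show ?thesis using p0 by simp
      next
        case 2
        then have "p h0 \<le> (1/t) * p (\<lambda>i. t * h0 i)"
          using hom[of "1/t" "\<lambda>i. t * h0 i"] by simp
        then show ?thesis using 2 by (simp add: field_simps)
      next
        case 3
        have "0 \<le> p (\<lambda>i. t * h0 i) + p (\<lambda>i. - t * h0 i)"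
          using sub[of "\<lambda>i. t * h0 i" "\<lambda>i. - t * h0 i"] p0 by simp
        moreover have "p (\<lambda>i. - t * h0 i) \<le> - t * p h0"
          using hom[of "- t" h0] 3 by simp
        ultimately show ?thesis by simp
      qed
    qed
    then show ?case by (simp add: E_def)
  next
    case (insert j J)
    then obtain \<pi> where \<pi>: "\<And>t h. t * p h0 + (\<Sum>i\<in>J. \<pi> i * h i) \<le> p (E J t h)" by blast
    define e :: "'i \<Rightarrow> real" where "e = (\<lambda>i. if i = j then 1 else 0)"
    define lo where "lo = (\<lambda>(t, h). t * p h0 + (\<Sum>i\<in>J. \<pi> i * h i) - p (\<lambda>i. E J t h i - e i))"
    \<comment> \<open>Extending to the direction \<open>e\<close> requires a value for
      \<open>e\<close> above every \<open>lo\<close> and below every expression on the right. Such a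
      value exists because \<open>- e\<close> and \<open>e\<close> cancel under
      subadditivity.\<close>
    have lohi: "lo (t, h) \<le> p (\<lambda>i. E J t' h' i + e i) - (t' * p h0 + (\<Sum>i\<in>J. \<pi> i * h' i))"
      for t h t' h'
    proof -
      have "(t + t') * p h0 + (\<Sum>i\<in>J. \<pi> i * (h i + h' i)) \<le> p (E J (t + t') (\<lambda>i. h i + h' i))"
        by (rule \<pi>)
      also have "E J (t + t') (\<lambda>i. h i + h' i) = (\<lambda>i. (E J t h i - e i) + (E J t' h' i + e i))"
        by (auto simp: E_def algebra_simps)
      also have "p \<dots> \<le> p (\<lambda>i. E J t h i - e i) + p (\<lambda>i. E J t' h' i + e i)"
        by (rule sub)
      finally show ?thesis
        by (simp add: lo_def algebra_simps sum.distrib)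
    qed
    define \<xi> where "\<xi> = (SUP z. lo z)"
    have "bdd_above (range lo)"
      using lohi[of _ _ 0 "\<lambda>_. 0"] by (intro bdd_aboveI2[where M = "p (\<lambda>i. E J 0 (\<lambda>_. 0) i + e i) - (0 * p h0 + (\<Sum>i\<in>J. \<pi> i * 0))"]) auto
    then have lo: "lo (t, h) \<le> \<xi>" for t h
      unfolding \<xi>_def by (rule cSUP_upper[OF UNIV_I])
    have hi: "\<xi> \<le> p (\<lambda>i. E J t h i + e i) - (t * p h0 + (\<Sum>i\<in>J. \<pi> i * h i))" for t h
      unfolding \<xi>_def using lohi by (intro cSUP_least) auto
    define \<pi>' where "\<pi>' = \<pi>(j := \<xi>)"
    have "t * p h0 + (\<Sum>i\<in>insert j J. \<pi>' i * h i) \<le> p (E (insert j J) t h)" for t h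
    proof -
      have S: "(\<Sum>i\<in>insert j J. \<pi>' i * h i) = \<xi> * h j + (\<Sum>i\<in>J. \<pi> i * h i)"
        using insert.hyps by (auto simp: \<pi>'_def intro!: sum.cong)
      have Eins: "E (insert j J) t h = (\<lambda>i. E J t h i + h j * e i)"
        using insert.hyps by (auto simp: E_def e_def)
      have scale: "E J (t / r) (\<lambda>i. h i / r) = (\<lambda>i. E J t h i / r)" for r
        by (auto simp: E_def add_divide_distrib)
      have sumscale: "(\<Sum>i\<in>J. \<pi> i * (h i / r)) = (\<Sum>i\<in>J. \<pi> i * h i) / r" for r
        by (simp add: sum_divide_distrib)
      \<comment> \<open>By homogeneity only the coefficients 0, 1 and -1 of \<open>e\<close> matter:
        division by \<open>\<bar>h j\<bar>\<close> reduces the last two cases to \<open>hi\<close>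
        and \<open>lo\<close>.\<close>
      consider "h j = 0" | "h j > 0" | "h j < 0" by linarith
      then show ?thesis
      proof cases
        case 1
        then show ?thesis using \<pi>[of t h] unfolding S Eins by simp
      next
        case 2
        define r where "r = h j"
        have r: "r > 0" using 2 by (simp add: r_def)
        have "\<xi> + (t / r * p h0 + (\<Sum>i\<in>J. \<pi> i * h i) / r) \<le> p (\<lambda>i. E J t h i / r + e i)"
          using hi[of "t / r" "\<lambda>i. h i / r"] unfolding scale sumscale by simp
        also have "(\<lambda>i. E J t h i / r + e i) = (\<lambda>i. (1 / r) * (E J t h i + r * e i))"
          using r by (auto simp: field_simps)
        also have "p \<dots> \<le> (1 / r) * p (\<lambda>i. E J t h i + r * e i)"
          using r by (intro hom) simp
        finally have "(\<xi> + (t / r * p h0 + (\<Sum>i\<in>J. \<pi> i * h i) / r)) * r \<le> p (\<lambda>i. E J t h i + r * e i)"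
          using r by (simp add: pos_le_divide_eq)
        then show ?thesis
          using r unfolding S Eins r_def[symmetric] by (simp add: distrib_right add.commute add.left_commute)
      next
        case 3
        define r where "r = - h j"
        have r: "r > 0" using 3 by (simp add: r_def)
        have hj: "h j = - r" by (simp add: r_def)
        have "t / r * p h0 + (\<Sum>i\<in>J. \<pi> i * h i) / r - \<xi> \<le> p (\<lambda>i. E J t h i / r - e i)"
          using lo[of "t / r" "\<lambda>i. h i / r"] unfolding lo_def prod.case scale sumscale by simp
        also have "(\<lambda>i. E J t h i / r - e i) = (\<lambda>i. (1 / r) * (E J t h i + - r * e i))"
          using r by (auto simp: field_simps)
        also have "p \<dots> \<le> (1 / r) * p (\<lambda>i. E J t h i + - r * e i)"
          using r by (intro hom) simp
        finally have "(t / r * p h0 + (\<Sum>i\<in>J. \<pi> i * h i) / r - \<xi>) * r \<le> p (\<lambda>i. E J t h i + - r * e i)"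
          using r by (simp add: pos_le_divide_eq)
        then show ?thesis
          using r unfolding S Eins hj by (simp add: distrib_right left_diff_distrib)
      qed
    qed
    then show ?case by blast
  qed
  from ext[OF \<open>finite I\<close>] obtain \<pi>
    where \<pi>: "\<And>t h. t * p h0 + (\<Sum>i\<in>I. \<pi> i * h i) \<le> p (E I t h)" by blast
  have le: "(\<Sum>i\<in>I. \<pi> i * h i) \<le> p h" for h
  proof -
    have "(\<Sum>i\<in>I. \<pi> i * h i) \<le> p (E I 0 h)" using \<pi>[of 0 h] by simp
    also have "p (E I 0 h) = p h" by (rule loc) (simp add: E_def)
    finally show ?thesis .
  qed
  \<comment> \<open>Here \<open>h0\<close> and \<open>- h0\<close> cancel on \<open>I\<close>, so
    the bound at \<open>t = 1\<close> yields the inequality opposite to \<open>le\<close> at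
    \<open>h0\<close>.\<close>
  have "p (E I 1 (\<lambda>i. - h0 i)) = p (\<lambda>_. 0)" by (rule loc) (simp add: E_def)
  then have "p h0 \<le> (\<Sum>i\<in>I. \<pi> i * h0 i)"
    using \<pi>[of 1 "\<lambda>i. - h0 i"] p0 by (simp add: sum_negf)
  with le show thesis by (intro that[of \<pi>]) (auto intro: antisym)
qed

section \<open>Kantorovich duality between finite sets\<close>

definition couplings ::
  "'a set \<Rightarrow> 'b set \<Rightarrow> ('a \<Rightarrow> real) \<Rightarrow> ('b \<Rightarrow> real) \<Rightarrow> ('a \<Rightarrow> 'b \<Rightarrow> real) set" where
  "couplings A B a b = {\<pi>.
     (\<forall>x\<in>A. \<forall>y\<in>B. \<pi> x y \<ge> 0) \<and>
     (\<forall>x\<in>A. (\<Sum>y\<in>B. \<pi> x y) = a x) \<and>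
     (\<forall>y\<in>B. (\<Sum>x\<in>A. \<pi> x y) = b y)}"

text \<open>A separable integrand sees only the marginals. This gives weak duality and, with the
  constants 1 and 0, the total mass.\<close>

lemma sum_coupling_split:
  assumes "\<pi> \<in> couplings A B a b"
  shows "(\<Sum>x\<in>A. \<Sum>y\<in>B. \<pi> x y * (f x + g y)) = (\<Sum>x\<in>A. f x * a x) + (\<Sum>y\<in>B. g y * b y)"
proof -
  have "(\<Sum>x\<in>A. \<Sum>y\<in>B. \<pi> x y * (f x + g y))
      = (\<Sum>x\<in>A. \<Sum>y\<in>B. f x * \<pi> x y) + (\<Sum>x\<in>A. \<Sum>y\<in>B. g y * \<pi> x y)"
    by (simp add: sum.distrib algebra_simps)
  also have "(\<Sum>x\<in>A. \<Sum>y\<in>B. g y * \<pi> x y) = (\<Sum>y\<in>B. \<Sum>x\<in>A. g y * \<pi> x y)"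
    by (rule sum.swap)
  finally show ?thesis
    using assms by (simp add: couplings_def sum_distrib_left[symmetric])
qed

text \<open>The bound \<open>K\<close> stands in for the dual supremum, so that no optimal dual pair
  has to be produced.\<close>

lemma kantorovich_duality:
  fixes a :: "'a \<Rightarrow> real" and b :: "'b \<Rightarrow> real" and c :: "'a \<Rightarrow> 'b \<Rightarrow> real"
  assumes "finite A" "finite B"
    and a: "\<And>x. x \<in> A \<Longrightarrow> a x \<ge> 0" "sum a A = 1"
    and b: "\<And>y. y \<in> B \<Longrightarrow> b y \<ge> 0" "sum b B = 1"
    and dual: "\<And>\<phi> \<psi>. (\<And>x y. x \<in> A \<Longrightarrow> y \<in> B \<Longrightarrow> \<phi> x + \<psi> y \<le> c x y) \<Longrightarrow>
      (\<Sum>x\<in>A. \<phi> x * a x) + (\<Sum>y\<in>B. \<psi> y * b y) \<le> K"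
  obtains \<pi> where "\<pi> \<in> couplings A B a b" and "(\<Sum>x\<in>A. \<Sum>y\<in>B. \<pi> x y * c x y) \<le> K"
proof -
  define val where "val \<phi> \<psi> = (\<Sum>x\<in>A. \<phi> x * a x) + (\<Sum>y\<in>B. \<psi> y * b y)" for \<phi> \<psi>
  define dom where "dom h = {val \<phi> \<psi> | \<phi> \<psi>. \<forall>x\<in>A. \<forall>y\<in>B. h (x, y) \<le> \<phi> x + \<psi> y}"
    for h :: "'a \<times> 'b \<Rightarrow> real"
  define p where "p h = Inf (dom h)" for h
  \<comment> \<open>The product coupling bounds \<open>dom h\<close> from below, so that the real
    infimum \<open>p h\<close> is a genuine one.\<close>
  have indep: "(\<lambda>x y. a x * b y) \<in> couplings A B a b"
    using a b by (simp add: couplings_def sum_distrib_left[symmetric] sum_distrib_right[symmetric])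
  have bdd: "bdd_below (dom h)" for h
  proof (rule bdd_belowI)
    fix v assume "v \<in> dom h"
    then obtain \<phi> \<psi> where v: "v = val \<phi> \<psi>" and "\<forall>x\<in>A. \<forall>y\<in>B. h (x, y) \<le> \<phi> x + \<psi> y"
      by (auto simp: dom_def)
    then have "(\<Sum>x\<in>A. \<Sum>y\<in>B. a x * b y * h (x, y)) \<le> (\<Sum>x\<in>A. \<Sum>y\<in>B. a x * b y * (\<phi> x + \<psi> y))"
      using a b by (intro sum_mono mult_left_mono) auto
    also have "\<dots> = v"
      unfolding v val_def by (rule sum_coupling_split[OF indep])
    finally show "(\<Sum>x\<in>A. \<Sum>y\<in>B. a x * b y * h (x, y)) \<le> v" .
  qed
  have ne: "dom h \<noteq> {}" for h
  proof -
    \<comment> \<open>A constant dominating \<open>h\<close> on the finite product serves as an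
      admissible pair.\<close>
    have "h (x, y) \<le> (\<Sum>z\<in>A \<times> B. \<bar>h z\<bar>) + 0" if "x \<in> A" "y \<in> B" for x y
      using member_le_sum[of "(x, y)" "A \<times> B" "\<lambda>z. \<bar>h z\<bar>"] that \<open>finite A\<close> \<open>finite B\<close> by auto
    then have "val (\<lambda>_. \<Sum>z\<in>A \<times> B. \<bar>h z\<bar>) (\<lambda>_. 0) \<in> dom h"
      unfolding dom_def by blast
    then show ?thesis by blast
  qed
  have p_le: "p h \<le> val \<phi> \<psi>" if "\<And>x y. x \<in> A \<Longrightarrow> y \<in> B \<Longrightarrow> h (x, y) \<le> \<phi> x + \<psi> y" for h \<phi> \<psi>
    unfolding p_def by (rule cInf_lower[OF _ bdd]) (use that in \<open>auto simp: dom_def\<close>)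
  have p_ge: "v \<le> p h"
    if "\<And>\<phi> \<psi>. (\<And>x y. x \<in> A \<Longrightarrow> y \<in> B \<Longrightarrow> h (x, y) \<le> \<phi> x + \<psi> y) \<Longrightarrow> v \<le> val \<phi> \<psi>" for h v
    unfolding p_def by (rule cInf_greatest[OF ne]) (use that in \<open>auto simp: dom_def\<close>)
  have sub: "p (\<lambda>i. g i + h i) \<le> p g + p h" for g h
  proof -
    have "p (\<lambda>i. g i + h i) - p h \<le> p g"
    proof (rule p_ge)
      fix \<phi> \<psi> assume 1: "\<And>x y. x \<in> A \<Longrightarrow> y \<in> B \<Longrightarrow> g (x, y) \<le> \<phi> x + \<psi> y"
      have "p (\<lambda>i. g i + h i) - val \<phi> \<psi> \<le> p h"
      proof (rule p_ge)
        fix \<phi>' \<psi>' assume 2: "\<And>x y. x \<in> A \<Longrightarrow> y \<in> B \<Longrightarrow> h (x, y) \<le> \<phi>' x + \<psi>' y"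
        have "p (\<lambda>i. g i + h i) \<le> val (\<lambda>x. \<phi> x + \<phi>' x) (\<lambda>y. \<psi> y + \<psi>' y)"
          using 1 2 by (intro p_le) (smt (verit))
        also have "\<dots> = val \<phi> \<psi> + val \<phi>' \<psi>'"
          by (simp add: val_def sum.distrib algebra_simps)
        finally show "p (\<lambda>i. g i + h i) - val \<phi> \<psi> \<le> val \<phi>' \<psi>'" by simp
      qed
      then show "p (\<lambda>i. g i + h i) - p h \<le> val \<phi> \<psi>" by simp
    qed
    then show ?thesis by simp
  qed
  have hom: "p (\<lambda>i. t * h i) \<le> t * p h" if "0 < t" for t h
  proof -
    have "p (\<lambda>i. t * h i) / t \<le> p h"
    proof (rule p_ge)
      fix \<phi> \<psi> assume 1: "\<And>x y. x \<in> A \<Longrightarrow> y \<in> B \<Longrightarrow> h (x, y) \<le> \<phi> x + \<psi> y"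
      have "p (\<lambda>i. t * h i) \<le> val (\<lambda>x. t * \<phi> x) (\<lambda>y. t * \<psi> y)"
        using 1 that by (intro p_le) (simp flip: distrib_left)
      also have "\<dots> = t * val \<phi> \<psi>"
        by (simp add: val_def sum_distrib_left algebra_simps)
      finally show "p (\<lambda>i. t * h i) / t \<le> val \<phi> \<psi>" using that by (simp add: field_simps)
    qed
    then show ?thesis using that by (simp add: field_simps)
  qed
  have loc: "p g = p h" if "\<And>i. i \<in> A \<times> B \<Longrightarrow> g i = h i" for g h
    using that by (auto simp: p_def dom_def)
  \<comment> \<open>The functional touches \<open>p\<close> at \<open>- c\<close>: pairs dominating
    \<open>- c\<close> are the negatives of dual feasible pairs, so \<open>p\<close> at
    \<open>- c\<close> is at least \<open>- K\<close>, which bounds the cost by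
    \<open>K\<close>.\<close>
  obtain \<sigma> where le: "\<And>h. (\<Sum>i\<in>A \<times> B. \<sigma> i * h i) \<le> p h"
    and eq: "(\<Sum>i\<in>A \<times> B. \<sigma> i * - (case i of (x, y) \<Rightarrow> c x y)) = p (\<lambda>i. - (case i of (x, y) \<Rightarrow> c x y))"
    using hahn_banach_coordinates[of "A \<times> B" p "\<lambda>i. - (case i of (x, y) \<Rightarrow> c x y)", OF _ sub hom loc]
      \<open>finite A\<close> \<open>finite B\<close> by blast
  define \<pi> where "\<pi> x y = \<sigma> (x, y)" for x y
  have le2: "(\<Sum>x\<in>A. \<Sum>y\<in>B. \<pi> x y * h x y) \<le> val \<phi> \<psi>"
    if "\<And>x y. x \<in> A \<Longrightarrow> y \<in> B \<Longrightarrow> h x y \<le> \<phi> x + \<psi> y" for h \<phi> \<psi>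
    using order_trans[OF le p_le[of "\<lambda>(x, y). h x y" \<phi> \<psi>]] that
    by (simp add: \<pi>_def sum.cartesian_product case_prod_unfold)
  have "\<pi> \<in> couplings A B a b"
    unfolding couplings_def
  proof (intro CollectI conjI ballI)
    fix x y assume xy: "x \<in> A" "y \<in> B"
    \<comment> \<open>Minus the indicator of a point lies below the zero pair, whose value is
      0.\<close>
    have "(\<Sum>x'\<in>A. \<Sum>y'\<in>B. \<pi> x' y' * (if x' = x then if y' = y then -1 else 0 else 0)) \<le> val (\<lambda>_. 0) (\<lambda>_. 0)"
      by (rule le2) auto
    also have "(\<Sum>x'\<in>A. \<Sum>y'\<in>B. \<pi> x' y' * (if x' = x then if y' = y then -1 else 0 else 0))
        = (\<Sum>x'\<in>A. if x' = x then (\<Sum>y'\<in>B. if y' = y then - \<pi> x' y' else 0) else 0)"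
      by (intro sum.cong refl) (auto intro!: sum.cong)
    also have "\<dots> = - \<pi> x y"
      using xy \<open>finite A\<close> \<open>finite B\<close> by simp
    finally show "\<pi> x y \<ge> 0" by (simp add: val_def)
  next
    fix x assume x: "x \<in> A"
    \<comment> \<open>A multiple \<open>s\<close> of the indicator of a row is itself a separable
      function; taking both signs of \<open>s\<close> turns the domination by \<open>p\<close> into
      an equality of marginals. Columns are treated alike below.\<close>
    have sum1: "(\<Sum>x'\<in>A. \<Sum>y'\<in>B. \<pi> x' y' * (if x' = x then s else 0)) = s * (\<Sum>y'\<in>B. \<pi> x y')" for s
    proof -
      have "(\<Sum>x'\<in>A. \<Sum>y'\<in>B. \<pi> x' y' * (if x' = x then s else 0))
        = (\<Sum>x'\<in>A. if x' = x then s * (\<Sum>y'\<in>B. \<pi> x' y') else 0)"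
        by (intro sum.cong refl) (auto simp: sum_distrib_left mult.commute)
      then show ?thesis using x \<open>finite A\<close> by simp
    qed
    have val1: "val (\<lambda>x'. if x' = x then s else 0) (\<lambda>_. 0) = s * a x" for s
      using x \<open>finite A\<close> by (simp add: val_def if_distrib[of "\<lambda>z. z * _"] cong: if_cong)
    have "s * (\<Sum>y'\<in>B. \<pi> x y') \<le> s * a x" for s
      unfolding sum1[symmetric] val1[symmetric] by (rule le2) simp
    from this[of 1] this[of "-1"] show "(\<Sum>y\<in>B. \<pi> x y) = a x" by simp
  next
    fix y assume y: "y \<in> B"
    have sum1: "(\<Sum>x'\<in>A. \<Sum>y'\<in>B. \<pi> x' y' * (if y' = y then s else 0)) = s * (\<Sum>x'\<in>A. \<pi> x' y)" for s
      using y \<open>finite B\<close>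
      by (simp add: if_distrib[of "\<lambda>z. _ * z"] sum_distrib_left mult.commute cong: if_cong)
    have val1: "val (\<lambda>_. 0) (\<lambda>y'. if y' = y then s else 0) = s * b y" for s
      using y \<open>finite B\<close> by (simp add: val_def if_distrib[of "\<lambda>z. z * _"] cong: if_cong)
    have "s * (\<Sum>x'\<in>A. \<pi> x' y) \<le> s * b y" for s
      unfolding sum1[symmetric] val1[symmetric] by (rule le2) simp
    from this[of 1] this[of "-1"] show "(\<Sum>x\<in>A. \<pi> x y) = b y" by simp
  qed
  moreover have "- K \<le> p (\<lambda>i. - (case i of (x, y) \<Rightarrow> c x y))"
  proof (rule p_ge)
    fix \<phi> \<psi> assume "\<And>x y. x \<in> A \<Longrightarrow> y \<in> B \<Longrightarrow> - (case (x, y) of (x, y) \<Rightarrow> c x y) \<le> \<phi> x + \<psi> y"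
    then have "(\<Sum>x\<in>A. - \<phi> x * a x) + (\<Sum>y\<in>B. - \<psi> y * b y) \<le> K"
      by (intro dual) force
    then show "- K \<le> val \<phi> \<psi>" by (simp add: val_def sum_negf)
  qed
  then have "(\<Sum>x\<in>A. \<Sum>y\<in>B. \<pi> x y * c x y) \<le> K"
    unfolding eq[symmetric] by (simp add: sum_negf \<pi>_def sum.cartesian_product case_prod_unfold)
  ultimately show thesis by (rule that)
qed

section \<open>Combinatorial distance, balls and spheres\<close>

context weighted_graph
begin

abbreviation d :: "'a \<Rightarrow> 'a \<Rightarrow> nat" where "d \<equiv> gdist V w"

lemma adj_sym: "adj V w x y \<longleftrightarrow> adj V w y x"
  using weight_sym by (auto simp: adj_def)

lemma gdist_le_walk: "(adj V w ^^ n) x y \<Longrightarrow> d x y \<le> n"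
  by (auto simp: gdist_def intro: cInf_lower)

text \<open>Connectedness makes the set of walk lengths non-empty, so the infimum in the naturals is
  attained and the default value of \<open>Inf {}\<close> never occurs.\<close>

lemma gdist_walk:
  assumes "x \<in> V" "y \<in> V"
  shows "(adj V w ^^ d x y) x y"
proof -
  have "{n. (adj V w ^^ n) x y} \<noteq> {}"
    using connected_graph[OF assms] by (auto dest: rtranclp_imp_relpowp)
  from Inf_nat_def1[OF this] show ?thesis by (simp add: gdist_def)
qed

lemma gdist_triangle:
  assumes "x \<in> V" "y \<in> V" "z \<in> V"
  shows "d x z \<le> d x y + d y z"
proof -
  have "(adj V w ^^ (d x y + d y z)) x z"
    unfolding relpowp_add using gdist_walk assms by blast
  then show ?thesis by (rule gdist_le_walk)
qed

lemma walk_sym: "(adj V w ^^ n) x y \<Longrightarrow> (adj V w ^^ n) y x"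
proof (induction n arbitrary: y)
  case (Suc n)
  then obtain z where "(adj V w ^^ n) x z" "adj V w z y" by auto
  then show ?case using Suc.IH adj_sym relpowp_Suc_I2 by metis
qed simp

lemma gdist_sym: "x \<in> V \<Longrightarrow> y \<in> V \<Longrightarrow> d x y = d y x"
  by (simp add: antisym gdist_le_walk gdist_walk walk_sym)

lemma gdist_self [simp]: "d x x = 0"
  using gdist_le_walk[of 0 x x] by simp

lemma gdist_eq_0_iff: "x \<in> V \<Longrightarrow> y \<in> V \<Longrightarrow> d x y = 0 \<longleftrightarrow> x = y"
  using gdist_walk[of x y] by auto

text \<open>A walk with one edge is an edge, and the zero diagonal of \<open>w\<close> rules out
  loops, hence edges between points at distance zero.\<close>

lemma gdist_eq_1_iff:
  assumes "x \<in> V" "y \<in> V"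
  shows "d x y = 1 \<longleftrightarrow> adj V w x y"
proof
  assume "d x y = 1"
  then show "adj V w x y" using gdist_walk[OF assms] by auto
next
  assume *: "adj V w x y"
  then have "d x y \<le> 1" by (intro gdist_le_walk) auto
  moreover have "x \<noteq> y" using * weight_diag by (auto simp: adj_def)
  ultimately show "d x y = 1" using gdist_eq_0_iff[OF assms] by linarith
qed

lemma sphere1_eq: "x \<in> V \<Longrightarrow> sphere1 V w x = {y. adj V w x y}"
  using gdist_eq_1_iff by (auto simp: sphere1_def adj_def)

lemma ball1_eq: "x \<in> V \<Longrightarrow> ball1 V w x = insert x (sphere1 V w x)"
  using gdist_eq_0_iff by (auto simp: sphere1_def ball1_def le_Suc_eq)

lemma center_notin_sphere1 [simp]: "x \<notin> sphere1 V w x"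
  by (simp add: sphere1_def)

lemma finite_sphere1: "x \<in> V \<Longrightarrow> finite (sphere1 V w x)"
  using locally_finite by (simp add: sphere1_eq)

lemma finite_ball1: "x \<in> V \<Longrightarrow> finite (ball1 V w x)"
  by (simp add: ball1_eq finite_sphere1)

lemma ball1_subset: "ball1 V w x \<subseteq> V"
  by (auto simp: ball1_def)

section \<open>Degrees and jump measures\<close>

lemma weight_eq_0:
  assumes "x \<in> V" "y \<in> V" "y \<notin> sphere1 V w x"
  shows "w x y = 0"
  using assms weight_nonneg[of x y] by (auto simp: sphere1_eq adj_def)

text \<open>Weights vanish off the finite sphere. The factor \<open>1 / m x\<close> is moved inside
  so that the summands match the marginals prescribed in \<open>transport_plans\<close>.\<close>

lemma Deg_eq:
  assumes "x \<in> V"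
  shows "Deg V w m x = (\<Sum>y\<in>sphere1 V w x. w x y / m x)"
proof -
  have "(\<Sum>\<^sub>\<infinity>y\<in>V. w x y) = (\<Sum>\<^sub>\<infinity>y\<in>sphere1 V w x. w x y)"
    using assms weight_eq_0 by (intro infsum_cong_neutral) (auto simp: sphere1_def)
  then show ?thesis
    using assms by (simp add: Deg_def finite_sphere1 sum_divide_distrib)
qed

lemma Deg_nonneg: "x \<in> V \<Longrightarrow> Deg V w m x \<ge> 0"
  using weight_nonneg measure_pos
  by (auto simp: Deg_eq sphere1_def intro!: sum_nonneg divide_nonneg_pos)

lemma jump_measure_nonneg:
  assumes "x \<in> V" "y \<in> V" "\<epsilon> \<ge> 0" "\<epsilon> * Deg V w m x \<le> 1"
  shows "jump_measure V w m \<epsilon> x y \<ge> 0"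
  using assms weight_nonneg[of x y] measure_pos[of x] by (simp add: jump_measure_def)

lemma jump_measure_sphere1:
  "y \<in> sphere1 V w x \<Longrightarrow> jump_measure V w m \<epsilon> x y = \<epsilon> * (w x y / m x)"
  by (auto simp: jump_measure_def)

lemma sum_jump_measure:
  assumes "x \<in> V"
  shows "(\<Sum>y\<in>ball1 V w x. jump_measure V w m \<epsilon> x y) = 1"
proof -
  have "(\<Sum>y\<in>sphere1 V w x. jump_measure V w m \<epsilon> x y) = \<epsilon> * Deg V w m x"
    unfolding Deg_eq[OF assms] sum_distrib_left
    by (rule sum.cong) (simp_all add: jump_measure_sphere1)
  then show ?thesis
    using assms by (simp add: ball1_eq finite_sphere1 jump_measure_def[of V w m \<epsilon> x x])
qed

text \<open>Stated through \<open>has_sum\<close> because the measures at two centres live on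
  different balls and their sums over \<open>V\<close> have to be combined.\<close>

lemma has_sum_jump_measure:
  assumes "x \<in> V"
  shows "((\<lambda>z. f z * jump_measure V w m \<epsilon> x z) has_sum
    (\<Sum>z\<in>ball1 V w x. f z * jump_measure V w m \<epsilon> x z)) V"
proof -
  have zero: "f z * jump_measure V w m \<epsilon> x z = 0" if "z \<in> V - ball1 V w x" for z
    using that assms weight_eq_0[of x z] by (auto simp: ball1_eq jump_measure_def)
  have "((\<lambda>z. f z * jump_measure V w m \<epsilon> x z) has_sum
    (\<Sum>z\<in>ball1 V w x. f z * jump_measure V w m \<epsilon> x z)) (ball1 V w x)"
    using finite_ball1[OF assms] by (rule has_sum_finite)
  then show ?thesis
    by (rule has_sum_cong_neutral[THEN iffD1, rotated -1]) (use zero ball1_subset in auto)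
qed

lemma infsum_jump_measure_diff:
  assumes "x \<in> V" "y \<in> V"
  shows "(\<Sum>\<^sub>\<infinity>z\<in>V. f z * (jump_measure V w m \<epsilon> x z - jump_measure V w m \<epsilon> y z))
    = (\<Sum>z\<in>ball1 V w x. f z * jump_measure V w m \<epsilon> x z)
      - (\<Sum>z\<in>ball1 V w y. f z * jump_measure V w m \<epsilon> y z)"
  using has_sum_add[OF has_sum_jump_measure[OF assms(1), of f \<epsilon>]
      has_sum_jump_measure[OF assms(2), of "\<lambda>z. - f z" \<epsilon>]]
  by (intro infsumI) (simp add: right_diff_distrib sum_negf)

section \<open>Duality for jump measures on the graph\<close>

abbreviation jump_couplings :: "real \<Rightarrow> 'a \<Rightarrow> 'a \<Rightarrow> ('a \<Rightarrow> 'a \<Rightarrow> real) set" where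
  "jump_couplings \<epsilon> x y \<equiv> couplings (ball1 V w x) (ball1 V w y)
     (jump_measure V w m \<epsilon> x) (jump_measure V w m \<epsilon> y)"

text \<open>Weak duality: for a Lipschitz \<open>f\<close>, the separable integrand
  \<open>f x - f y\<close> lies below the cost.\<close>

lemma dual_le_cost:
  assumes V: "x0 \<in> V" "y0 \<in> V" and \<pi>: "\<pi> \<in> jump_couplings \<epsilon> x0 y0" and f: "f \<in> Lip1 V w"
  shows "(\<Sum>\<^sub>\<infinity>z\<in>V. f z * (jump_measure V w m \<epsilon> x0 z - jump_measure V w m \<epsilon> y0 z))
    \<le> (\<Sum>x\<in>ball1 V w x0. \<Sum>y\<in>ball1 V w y0. \<pi> x y * d x y)"
proof -
  have "(\<Sum>\<^sub>\<infinity>z\<in>V. f z * (jump_measure V w m \<epsilon> x0 z - jump_measure V w m \<epsilon> y0 z))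
    = (\<Sum>x\<in>ball1 V w x0. \<Sum>y\<in>ball1 V w y0. \<pi> x y * (f x + - f y))"
    unfolding infsum_jump_measure_diff[OF V] sum_coupling_split[OF \<pi>] by (simp add: sum_negf)
  also have "\<dots> \<le> (\<Sum>x\<in>ball1 V w x0. \<Sum>y\<in>ball1 V w y0. \<pi> x y * d x y)"
  proof (intro sum_mono mult_left_mono)
    fix x y assume xy: "x \<in> ball1 V w x0" "y \<in> ball1 V w y0"
    then have "x \<in> V" "y \<in> V" using ball1_subset by auto
    then have "\<bar>f x - f y\<bar> \<le> d x y" using f by (simp add: Lip1_def)
    then show "f x + - f y \<le> d x y" by simp
    show "0 \<le> \<pi> x y" using xy \<pi> by (simp add: couplings_def)
  qed
  finally show ?thesis .
qed

text \<open>The cost of any single coupling is an upper bound; without one, the real supremum in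
  \<open>Wasserstein\<close> could not be compared with its members.\<close>

lemma bdd_above_dual:
  assumes "x0 \<in> V" "y0 \<in> V" "\<pi> \<in> jump_couplings \<epsilon> x0 y0"
  shows "bdd_above ((\<lambda>f. \<Sum>\<^sub>\<infinity>z\<in>V. f z * (jump_measure V w m \<epsilon> x0 z - jump_measure V w m \<epsilon> y0 z))
    ` {f \<in> Lip1 V w. bounded (f ` V)})"
  by (rule bdd_aboveI2) (use dual_le_cost[OF assms] in auto)

lemma Wasserstein_le_cost:
  assumes "x0 \<in> V" "y0 \<in> V" "\<pi> \<in> jump_couplings \<epsilon> x0 y0"
  shows "Wasserstein V w (jump_measure V w m \<epsilon> x0) (jump_measure V w m \<epsilon> y0)
    \<le> (\<Sum>x\<in>ball1 V w x0. \<Sum>y\<in>ball1 V w y0. \<pi> x y * d x y)"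
proof -
  have "(\<lambda>_. 0) \<in> {f \<in> Lip1 V w. bounded (f ` V)}"
    by (auto simp: Lip1_def intro: bounded_subset[of "{0}"])
  then show ?thesis
    unfolding Wasserstein_def using dual_le_cost[OF assms] by (intro cSUP_least) auto
qed

text \<open>The inf-convolution of \<open>\<phi>\<close> with the distance, truncated so as to be bounded, replaces a
  dual pair by a single Lipschitz function without decreasing the dual value.\<close>

lemma Lip1_of_dual_pair:
  fixes \<phi> \<psi> :: "'a \<Rightarrow> real"
  assumes fin: "finite A" "finite B" and sub: "A \<subseteq> V" "B \<subseteq> V"
    and le: "\<And>x y. x \<in> A \<Longrightarrow> y \<in> B \<Longrightarrow> \<phi> x + \<psi> y \<le> d x y"
  obtains f where "f \<in> Lip1 V w" "bounded (f ` V)"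
    "\<And>x. x \<in> A \<Longrightarrow> \<phi> x \<le> f x" "\<And>y. y \<in> B \<Longrightarrow> \<psi> y \<le> - f y"
proof -
  \<comment> \<open>The level \<open>- M\<close> lies below every \<open>- \<psi> y\<close> with
    \<open>y \<in> B\<close>, so truncating there preserves \<open>f \<le> - \<psi>\<close> on
    \<open>B\<close>. It also keeps the set under the maximum non-empty.\<close>
  define M where "M = (\<Sum>y\<in>B. \<bar>\<psi> y\<bar>)"
  define S where "S v = insert (- M) ((\<lambda>x. \<phi> x - d v x) ` A)" for v
  define f where "f v = Max (S v)" for v
  have S: "finite (S v)" "S v \<noteq> {}" for v using fin by (auto simp: S_def)
  \<comment> \<open>A maximum of 1-Lipschitz functions is 1-Lipschitz; for each entry this is the
    triangle inequality.\<close>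
  have step: "f u \<le> f v + d u v" if uv: "u \<in> V" "v \<in> V" for u v
  proof -
    have "s \<le> f v + d u v" if "s \<in> S u" for s
    proof -
      consider "s = - M" | x where "x \<in> A" "s = \<phi> x - d u x"
        using \<open>s \<in> S u\<close> by (auto simp: S_def)
      then show ?thesis
      proof cases
        case 1
        moreover have "- M \<le> f v" unfolding f_def by (rule Max_ge[OF S(1)]) (simp add: S_def)
        ultimately show ?thesis by simp
      next
        case 2
        have "\<phi> x - d v x \<le> f v" unfolding f_def using 2 by (intro Max_ge[OF S(1)]) (simp add: S_def)
        moreover have "d v x \<le> d v u + d u x" using 2 sub uv by (intro gdist_triangle) auto
        moreover have "d v u = d u v" using uv by (intro gdist_sym)
        ultimately show ?thesis using 2 by linarith
      qed
    qed
    then show ?thesis unfolding f_def[of u] using S by simp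
  qed
  have "f \<in> Lip1 V w"
    unfolding Lip1_def
  proof (intro CollectI ballI)
    fix u v assume "u \<in> V" "v \<in> V"
    with step[of u v] step[of v u] gdist_sym[of u v] show "\<bar>f u - f v\<bar> \<le> d u v" by simp
  qed
  moreover have "bounded (f ` V)"
  proof (rule boundedI)
    fix r assume "r \<in> f ` V"
    then obtain v where r: "r = f v" by blast
    have "- M \<le> f v" unfolding f_def by (rule Max_ge[OF S(1)]) (simp add: S_def)
    moreover have "f v \<le> M + (\<Sum>x\<in>A. \<bar>\<phi> x\<bar>)"
      unfolding f_def
    proof (rule Max.boundedI[OF S])
      fix s assume "s \<in> S v"
      moreover have "M \<ge> 0" by (simp add: M_def sum_nonneg)
      moreover have "\<phi> x \<le> (\<Sum>x\<in>A. \<bar>\<phi> x\<bar>)" if "x \<in> A" for x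
        using member_le_sum[of x A "\<lambda>x. \<bar>\<phi> x\<bar>"] that fin by auto
      ultimately show "s \<le> M + (\<Sum>x\<in>A. \<bar>\<phi> x\<bar>)"
        by (fastforce simp: S_def intro: order_trans[OF _ sum_nonneg])
    qed
    moreover have "(\<Sum>x\<in>A. \<bar>\<phi> x\<bar>) \<ge> 0" by (simp add: sum_nonneg)
    ultimately show "norm r \<le> M + (\<Sum>x\<in>A. \<bar>\<phi> x\<bar>)" unfolding r real_norm_def by linarith
  qed
  moreover have "\<phi> x \<le> f x" if "x \<in> A" for x
    unfolding f_def using that by (intro Max_ge[OF S(1)]) (force simp: S_def)
  moreover have "\<psi> y \<le> - f y" if "y \<in> B" for y
  proof -
    have "\<psi> y \<le> M"
      using member_le_sum[of y B "\<lambda>y. \<bar>\<psi> y\<bar>"] that fin by (auto simp: M_def)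
    moreover have "\<phi> x - d y x \<le> - \<psi> y" if "x \<in> A" for x
    proof -
      have "d x y = d y x" using sub that \<open>y \<in> B\<close> by (intro gdist_sym) auto
      with le[OF that \<open>y \<in> B\<close>] show ?thesis by simp
    qed
    ultimately have "f y \<le> - \<psi> y"
      unfolding f_def using S by (auto simp: S_def)
    then show ?thesis by simp
  qed
  ultimately show thesis by (rule that)
qed

text \<open>By \<open>Lip1_of_dual_pair\<close>, the Wasserstein value bounds every dual pair and
  may serve as \<open>K\<close> in \<open>kantorovich_duality\<close>; weak duality gives the
  reverse inequality. The bounds on \<open>\<epsilon>\<close> keep the masses at the centres
  non-negative.\<close>

lemma optimal_coupling_exists:
  assumes V: "x0 \<in> V" "y0 \<in> V"
    and \<epsilon>: "\<epsilon> \<ge> 0" "\<epsilon> * Deg V w m x0 \<le> 1" "\<epsilon> * Deg V w m y0 \<le> 1"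
  obtains \<pi> where "\<pi> \<in> jump_couplings \<epsilon> x0 y0"
    "(\<Sum>x\<in>ball1 V w x0. \<Sum>y\<in>ball1 V w y0. \<pi> x y * d x y)
      = Wasserstein V w (jump_measure V w m \<epsilon> x0) (jump_measure V w m \<epsilon> y0)"
proof -
  define a where "a = jump_measure V w m \<epsilon> x0"
  define b where "b = jump_measure V w m \<epsilon> y0"
  have a: "a x \<ge> 0" if "x \<in> ball1 V w x0" for x
    unfolding a_def using that ball1_subset assms by (intro jump_measure_nonneg) auto
  have b: "b y \<ge> 0" if "y \<in> ball1 V w y0" for y
    unfolding b_def using that ball1_subset assms by (intro jump_measure_nonneg) auto
  have ab1: "sum a (ball1 V w x0) = 1" "sum b (ball1 V w y0) = 1"
    unfolding a_def b_def using V by (simp_all add: sum_jump_measure)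
  \<comment> \<open>Any coupling would do here: it only supplies the boundedness of the dual
    set.\<close>
  have "(\<lambda>x y. a x * b y) \<in> jump_couplings \<epsilon> x0 y0"
    unfolding a_def[symmetric] b_def[symmetric] using a b ab1
    by (simp add: couplings_def sum_distrib_left[symmetric] sum_distrib_right[symmetric])
  note bdd = bdd_above_dual[OF V this]
  have dual: "(\<Sum>x\<in>ball1 V w x0. \<phi> x * a x) + (\<Sum>y\<in>ball1 V w y0. \<psi> y * b y) \<le> Wasserstein V w a b"
    if le: "\<And>x y. x \<in> ball1 V w x0 \<Longrightarrow> y \<in> ball1 V w y0 \<Longrightarrow> \<phi> x + \<psi> y \<le> d x y" for \<phi> \<psi> :: "'a \<Rightarrow> real"
  proof -
    obtain f where f: "f \<in> Lip1 V w" "bounded (f ` V)"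
      "\<And>x. x \<in> ball1 V w x0 \<Longrightarrow> \<phi> x \<le> f x" "\<And>y. y \<in> ball1 V w y0 \<Longrightarrow> \<psi> y \<le> - f y"
      using Lip1_of_dual_pair[OF finite_ball1[OF V(1)] finite_ball1[OF V(2)] ball1_subset ball1_subset le]
      by blast
    have "(\<Sum>x\<in>ball1 V w x0. \<phi> x * a x) + (\<Sum>y\<in>ball1 V w y0. \<psi> y * b y)
      \<le> (\<Sum>x\<in>ball1 V w x0. f x * a x) + (\<Sum>y\<in>ball1 V w y0. - f y * b y)"
      using f a b by (intro add_mono sum_mono mult_right_mono)
    also have "\<dots> = (\<Sum>\<^sub>\<infinity>z\<in>V. f z * (a z - b z))"
      unfolding a_def b_def infsum_jump_measure_diff[OF V] by (simp add: sum_negf)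
    also have "\<dots> \<le> Wasserstein V w a b"
      unfolding Wasserstein_def using f bdd by (intro cSUP_upper) (auto simp: a_def b_def)
    finally show ?thesis .
  qed
  obtain \<pi> where \<pi>: "\<pi> \<in> couplings (ball1 V w x0) (ball1 V w y0) a b"
    "(\<Sum>x\<in>ball1 V w x0. \<Sum>y\<in>ball1 V w y0. \<pi> x y * real (d x y)) \<le> Wasserstein V w a b"
    by (rule kantorovich_duality[OF finite_ball1[OF V(1)] finite_ball1[OF V(2)] a ab1(1) b ab1(2) dual])
  show thesis
    using \<pi> Wasserstein_le_cost[OF V, of \<pi> \<epsilon>] unfolding a_def b_def by (intro that[of \<pi>] antisym)
qed

section \<open>Rescaling between couplings and transport plans\<close>

abbreviation plan_value :: "'a \<Rightarrow> 'a \<Rightarrow> ('a \<Rightarrow> 'a \<Rightarrow> real) \<Rightarrow> real" where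
  "plan_value x0 y0 \<rho> \<equiv>
    \<Sum>x\<in>ball1 V w x0. \<Sum>y\<in>ball1 V w y0. \<rho> x y * (1 - real (d x y) / real (d x0 y0))"

text \<open>A coupling has total mass one, which produces the constant term. For an optimal coupling
  the right-hand side is \<open>curv_eps\<close>.\<close>

lemma plan_value_coupling:
  assumes "x0 \<in> V" "y0 \<in> V" "\<pi> \<in> jump_couplings \<epsilon> x0 y0"
  shows "plan_value x0 y0 \<pi>
    = 1 - (\<Sum>x\<in>ball1 V w x0. \<Sum>y\<in>ball1 V w y0. \<pi> x y * d x y) / d x0 y0"
proof -
  have "(\<Sum>x\<in>ball1 V w x0. \<Sum>y\<in>ball1 V w y0. \<pi> x y) = 1"
    using sum_coupling_split[OF assms(3), of "\<lambda>_. 1" "\<lambda>_. 0"] sum_jump_measure[OF assms(1)] by simp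
  then show ?thesis
    by (simp add: right_diff_distrib sum_subtractf sum_divide_distrib)
qed

text \<open>On the spheres the jump measures are \<open>\<epsilon>\<close> times the prescribed
  marginals; the constraints at the centres are simply dropped.\<close>

lemma transport_plan_of_coupling:
  assumes V: "x0 \<in> V" "y0 \<in> V" and "\<epsilon> > 0" and \<pi>: "\<pi> \<in> jump_couplings \<epsilon> x0 y0"
  shows "(\<lambda>x y. \<pi> x y / \<epsilon>) \<in> transport_plans V w m x0 y0"
  using \<pi> \<open>\<epsilon> > 0\<close> V
  by (auto simp: transport_plans_def couplings_def ball1_eq jump_measure_sphere1
      simp flip: sum_divide_distrib)

text \<open>The mass at the pair of centres does not affect the value, so it can be chosen to give the
  marginals total mass one. It is non-negative because the mass moved away from the centres is at
  most \<open>\<epsilon> * (Deg x0 + Deg y0)\<close>.\<close>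

lemma coupling_of_transport_plan:
  assumes V: "x0 \<in> V" "y0 \<in> V" "x0 \<noteq> y0" and "\<epsilon> > 0"
    and \<epsilon>: "\<epsilon> * (Deg V w m x0 + Deg V w m y0) \<le> 1"
    and \<rho>: "\<rho> \<in> transport_plans V w m x0 y0"
  obtains \<pi> where "\<pi> \<in> jump_couplings \<epsilon> x0 y0" "plan_value x0 y0 \<pi> = \<epsilon> * plan_value x0 y0 \<rho>"
proof -
  let ?X = "sphere1 V w x0" and ?Y = "sphere1 V w y0"
  note fin = finite_sphere1[OF V(1)] finite_sphere1[OF V(2)]
  note ball = ball1_eq[OF V(1)] ball1_eq[OF V(2)]
  have nn: "\<And>x y. x \<in> ball1 V w x0 \<Longrightarrow> y \<in> ball1 V w y0 \<Longrightarrow> \<rho> x y \<ge> 0"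
    and mx: "\<And>x. x \<in> ?X \<Longrightarrow> \<rho> x y0 + (\<Sum>y\<in>?Y. \<rho> x y) = w x0 x / m x0"
    and my: "\<And>y. y \<in> ?Y \<Longrightarrow> \<rho> x0 y + (\<Sum>x\<in>?X. \<rho> x y) = w y0 y / m y0"
    using \<rho> fin by (auto simp: transport_plans_def ball)
  define q where "q = 1 - \<epsilon> * Deg V w m x0 - \<epsilon> * (\<Sum>y\<in>?Y. \<rho> x0 y)"
  define \<pi> where "\<pi> x y = (if x = x0 \<and> y = y0 then q else \<epsilon> * \<rho> x y)" for x y
  have "Deg V w m x0 = (\<Sum>x\<in>?X. \<rho> x y0) + (\<Sum>x\<in>?X. \<Sum>y\<in>?Y. \<rho> x y)"
    unfolding Deg_eq[OF V(1)] sum.distrib[symmetric] by (rule sum.cong) (simp_all add: mx)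
  moreover have Dy: "Deg V w m y0 = (\<Sum>y\<in>?Y. \<rho> x0 y) + (\<Sum>y\<in>?Y. \<Sum>x\<in>?X. \<rho> x y)"
    unfolding Deg_eq[OF V(2)] sum.distrib[symmetric] by (rule sum.cong) (simp_all add: my)
  moreover have "(\<Sum>y\<in>?Y. \<Sum>x\<in>?X. \<rho> x y) = (\<Sum>x\<in>?X. \<Sum>y\<in>?Y. \<rho> x y)"
    by (rule sum.swap)
  \<comment> \<open>The value \<open>q\<close> was chosen to fit the row of \<open>x0\<close>. It
    also fits the column of \<open>y0\<close>, because both degrees contain the same mass exchanged
    between the two spheres.\<close>
  ultimately have q2: "q + \<epsilon> * (\<Sum>x\<in>?X. \<rho> x y0) = 1 - \<epsilon> * Deg V w m y0"
    by (simp add: q_def algebra_simps)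
  have "(\<Sum>y\<in>?Y. \<Sum>x\<in>?X. \<rho> x y) \<ge> 0"
    using nn by (intro sum_nonneg) (simp add: ball)
  then have "\<epsilon> * (\<Sum>y\<in>?Y. \<rho> x0 y) \<le> \<epsilon> * Deg V w m y0"
    using \<open>\<epsilon> > 0\<close> by (simp add: Dy)
  with \<epsilon> have q0: "q \<ge> 0" by (simp add: q_def distrib_left)
  have "\<pi> \<in> jump_couplings \<epsilon> x0 y0"
    unfolding couplings_def
  proof (intro CollectI conjI ballI)
    fix x y assume "x \<in> ball1 V w x0" "y \<in> ball1 V w y0"
    then show "\<pi> x y \<ge> 0" using q0 nn \<open>\<epsilon> > 0\<close> by (simp add: \<pi>_def)
  next
    fix x assume x: "x \<in> ball1 V w x0"
    show "(\<Sum>y\<in>ball1 V w y0. \<pi> x y) = jump_measure V w m \<epsilon> x0 x"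
    proof (cases "x = x0")
      case True
      have "(\<Sum>y\<in>?Y. \<pi> x0 y) = \<epsilon> * (\<Sum>y\<in>?Y. \<rho> x0 y)"
        unfolding sum_distrib_left by (rule sum.cong) (auto simp: \<pi>_def)
      then show ?thesis
        using True fin by (simp add: ball jump_measure_def) (simp add: \<pi>_def q_def)
    next
      case False
      then have "x \<in> ?X" using x by (simp add: ball)
      then show ?thesis
        using False fin mx by (simp add: ball jump_measure_sphere1 \<pi>_def flip: sum_distrib_left distrib_left)
    qed
  next
    fix y assume y: "y \<in> ball1 V w y0"
    show "(\<Sum>x\<in>ball1 V w x0. \<pi> x y) = jump_measure V w m \<epsilon> y0 y"
    proof (cases "y = y0")
      case True
      have "(\<Sum>x\<in>?X. \<pi> x y0) = \<epsilon> * (\<Sum>x\<in>?X. \<rho> x y0)"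
        unfolding sum_distrib_left by (rule sum.cong) (auto simp: \<pi>_def)
      then show ?thesis
        using True fin q2 by (simp add: ball jump_measure_def) (simp add: \<pi>_def)
    next
      case False
      then have "y \<in> ?Y" using y by (simp add: ball)
      then show ?thesis
        using False fin my by (simp add: ball jump_measure_sphere1 \<pi>_def flip: sum_distrib_left distrib_left)
    qed
  qed
  \<comment> \<open>The coefficient at the centres is zero because \<open>x0 \<noteq> y0\<close>
    makes the denominator non-zero; with \<open>0 / 0 = 0\<close> it would be 1 instead.\<close>
  moreover have "plan_value x0 y0 \<pi> = \<epsilon> * plan_value x0 y0 \<rho>"
    unfolding sum_distrib_left using V gdist_eq_0_iff[of x0 y0] by (intro sum.cong refl) (simp add: \<pi>_def)
  ultimately show thesis by (rule that)
qed

section \<open>The supremum at a fixed small time and the limit\<close>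

text \<open>The supremum is a maximum: a rescaled optimal coupling attains the value, and completing
  an arbitrary plan to a coupling shows that no plan exceeds it.\<close>

lemma SUP_plan_value:
  assumes V: "x0 \<in> V" "y0 \<in> V" "x0 \<noteq> y0" and "\<epsilon> > 0"
    and \<epsilon>: "\<epsilon> * (Deg V w m x0 + Deg V w m y0) \<le> 1"
  shows "(SUP \<rho> \<in> transport_plans V w m x0 y0. plan_value x0 y0 \<rho>)
    = (1 / \<epsilon>) * curv_eps V w m \<epsilon> x0 y0"
proof (rule cSup_eq_maximum)
  have "\<epsilon> * Deg V w m x0 \<ge> 0" "\<epsilon> * Deg V w m y0 \<ge> 0"
    using Deg_nonneg V \<open>\<epsilon> > 0\<close> by simp_all
  then have le: "\<epsilon> * Deg V w m x0 \<le> 1" "\<epsilon> * Deg V w m y0 \<le> 1"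
    using \<epsilon> unfolding distrib_left by linarith+
  obtain \<pi> where \<pi>: "\<pi> \<in> jump_couplings \<epsilon> x0 y0"
    "(\<Sum>x\<in>ball1 V w x0. \<Sum>y\<in>ball1 V w y0. \<pi> x y * d x y)
      = Wasserstein V w (jump_measure V w m \<epsilon> x0) (jump_measure V w m \<epsilon> y0)"
    by (rule optimal_coupling_exists[OF V(1,2) less_imp_le[OF \<open>\<epsilon> > 0\<close>] le])
  have "(1 / \<epsilon>) * curv_eps V w m \<epsilon> x0 y0 = (1 / \<epsilon>) * plan_value x0 y0 \<pi>"
    unfolding plan_value_coupling[OF V(1,2) \<pi>(1)] \<pi>(2) by (simp add: curv_eps_def)
  also have "\<dots> = plan_value x0 y0 (\<lambda>x y. \<pi> x y / \<epsilon>)"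
    by (simp add: sum_distrib_left)
  finally show "(1 / \<epsilon>) * curv_eps V w m \<epsilon> x0 y0 \<in> plan_value x0 y0 ` transport_plans V w m x0 y0"
    using transport_plan_of_coupling[OF V(1,2) \<open>\<epsilon> > 0\<close> \<pi>(1)] by (rule image_eqI)
next
  fix v assume "v \<in> plan_value x0 y0 ` transport_plans V w m x0 y0"
  then obtain \<rho> where \<rho>: "\<rho> \<in> transport_plans V w m x0 y0" and v: "v = plan_value x0 y0 \<rho>" by blast
  obtain \<pi> where \<pi>: "\<pi> \<in> jump_couplings \<epsilon> x0 y0" "plan_value x0 y0 \<pi> = \<epsilon> * plan_value x0 y0 \<rho>"
    by (rule coupling_of_transport_plan[OF V \<open>\<epsilon> > 0\<close> \<epsilon> \<rho>])
  have "\<epsilon> * v = 1 - (\<Sum>x\<in>ball1 V w x0. \<Sum>y\<in>ball1 V w y0. \<pi> x y * d x y) / d x0 y0"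
    unfolding v \<pi>(2)[symmetric] by (rule plan_value_coupling[OF V(1,2) \<pi>(1)])
  also have "\<dots> \<le> curv_eps V w m \<epsilon> x0 y0"
    unfolding curv_eps_def using Wasserstein_le_cost[OF V(1,2) \<pi>(1)]
    by (intro diff_left_mono divide_right_mono) auto
  finally show "v \<le> (1 / \<epsilon>) * curv_eps V w m \<epsilon> x0 y0"
    using \<open>\<epsilon> > 0\<close> by (simp add: field_simps)
qed

text \<open>The supremum does not depend on \<open>\<epsilon>\<close>, so the quotient is constant
  near zero and its limit exists trivially.\<close>

lemma curvature_eq:
  assumes "x0 \<in> V" "y0 \<in> V" "x0 \<noteq> y0"
  shows "curvature V w m x0 y0 = (SUP \<rho> \<in> transport_plans V w m x0 y0. plan_value x0 y0 \<rho>)"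
    (is "_ = ?S")
proof -
  let ?D = "Deg V w m x0 + Deg V w m y0"
  have D: "?D \<ge> 0" using Deg_nonneg assms by simp
  have "eventually (\<lambda>\<epsilon>. (1 / \<epsilon>) * curv_eps V w m \<epsilon> x0 y0 = ?S) (at_right 0)"
    unfolding eventually_at_right_field
  \<comment> \<open>The \<open>+ 1\<close> keeps the denominator positive using only
    \<open>?D \<ge> 0\<close>.\<close>
  proof (intro exI[of _ "1 / (?D + 1)"] conjI allI impI)
    fix \<epsilon> :: real assume \<epsilon>: "0 < \<epsilon>" "\<epsilon> < 1 / (?D + 1)"
    then have "\<epsilon> * (?D + 1) \<le> 1" using D by (simp add: field_simps)
    then have "\<epsilon> * ?D \<le> 1" using \<epsilon> by (simp add: distrib_left)
    then show "(1 / \<epsilon>) * curv_eps V w m \<epsilon> x0 y0 = ?S"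
      using SUP_plan_value[OF assms \<epsilon>(1)] by simp
  qed (use D in simp)
  then have "((\<lambda>\<epsilon>. (1 / \<epsilon>) * curv_eps V w m \<epsilon> x0 y0) \<longlongrightarrow> ?S) (at_right 0)"
    by (rule tendsto_eventually)
  then show ?thesis
    unfolding curvature_def by (intro tendsto_Lim) simp_all
qed

end

theorem proposition2p4:
  fixes V :: "'a set" and w :: "'a \<Rightarrow> 'a \<Rightarrow> real" and m :: "'a \<Rightarrow> real" and x0 y0 :: 'a
  assumes "weighted_graph V w m"
    and "x0 \<in> V" and "y0 \<in> V" and "x0 \<noteq> y0"
  shows "curvature V w m x0 y0 =
    (SUP \<rho> \<in> transport_plans V w m x0 y0.
      \<Sum>(x, y) \<in> ball1 V w x0 \<times> ball1 V w y0.
        \<rho> x y * (1 - real (gdist V w x y) / real (gdist V w x0 y0)))"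
  using weighted_graph.curvature_eq[OF assms] by (simp add: sum.cartesian_product)

end
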